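(* Let $\mathcal A,\mathcal B\subseteq\mathcal P(\omega)$ be arbitrary and assume that $(\mathcal P(\omega),\subseteq)$ has the weak Freese–Nation property. Then $\mathcal A$ has a $\mathcal B$-good coloring.
   Context: $(\mathcal P(\omega),\subseteq)$ has the weak Freese–Nation property if there is a function $f:\mathcal P(\omega)\to[\mathcal P(\omega)]^{\le\omega}$ such that for all $A\subseteq B\subseteq\omega$ there exists $C\in f(A)\cap f(B)$ with $A\subseteq C\subseteq B$. For $\mathcal A,\mathcal B\subseteq\mathcal P(\omega)$, a $\mathcal B$-good coloring of $\mathcal A$ is a function $c:\mathcal A\to\mathrm{On}$ such that for every $B\in\mathcal B$, if $|\mathcal P(B)\cap\mathcal A|\ge\omega_1$ then $|\mathcal P(B)\cap\mathcal A|\subseteq c[\mathcal P(B)\cap\mathcal A]$ (the cardinal being viewed as the set of smaller ordinals). *)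

theory Defs
  imports Main "HOL-Library.Countable_Set"
begin

unbundle cardinal_syntax

text \<open>HOL has no class of all ordinals. The type \<open>'a ordinal\<close> consists of the order types of
  the well-orders on subsets of \<open>'a\<close>, that is, of all ordinals of cardinality at most that of \<open>'a\<close>.\<close>

quotient_type 'a ordinal = "'a rel" / partial: "\<lambda>r s :: 'a rel. r =o s"
proof (rule part_equivpI)
  show "\<exists>r :: 'a rel. r =o r"
    using card_of_refl by blast
  show "symp (\<lambda>r s :: 'a rel. r =o s)"
    by (auto intro: sympI ordIso_symmetric)
  show "transp (\<lambda>r s :: 'a rel. r =o s)"
    by (auto intro: transpI ordIso_transitive)
qed

lemma ordIso_self_iff: "r =o r \<longleftrightarrow> Well_order r"
  using ordIso_reflexive by (auto simp: ordIso_def)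

instantiation ordinal :: (type) wellorder
begin

lift_definition less_eq_ordinal :: "'a ordinal \<Rightarrow> 'a ordinal \<Rightarrow> bool" is "\<lambda>r s. r \<le>o s"
  by (meson ordIso_ordLeq_trans ordIso_symmetric ordLeq_ordIso_trans)

lift_definition less_ordinal :: "'a ordinal \<Rightarrow> 'a ordinal \<Rightarrow> bool" is "\<lambda>r s. r <o s"
  by (meson ordIso_ordLess_trans ordIso_symmetric ordLess_ordIso_trans)

instance
proof
  fix x y z :: "'a ordinal"
  show "(x < y) = (x \<le> y \<and> \<not> y \<le> x)"
    by transfer (metis not_ordLess_ordLeq ordIso_self_iff ordLess_imp_ordLeq ordLess_or_ordLeq)
  show "x \<le> x"
    by transfer (rule ordIso_imp_ordLeq)
  show "x \<le> y \<Longrightarrow> y \<le> z \<Longrightarrow> x \<le> z"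
    by transfer (rule ordLeq_transitive)
  show "x \<le> y \<Longrightarrow> y \<le> x \<Longrightarrow> x = y"
    by transfer (simp add: ordIso_iff_ordLeq)
  show "x \<le> y \<or> y \<le> x"
    by transfer (metis ordLess_imp_ordLeq ordLess_or_ordLeq ordIso_self_iff)
next
  fix P :: "'a ordinal \<Rightarrow> bool" and a :: "'a ordinal"
  assume step: "\<And>x. (\<And>y. y < x \<Longrightarrow> P y) \<Longrightarrow> P x"
  have *: "r =o r \<Longrightarrow> P (abs_ordinal r)" for r
  proof (induction r rule: wf_induct_rule[OF wf_ordLess])
    case (1 r)
    show ?case
    proof (rule step)
      fix y assume y: "y < abs_ordinal r"
      define s where "s = rep_ordinal y"
      have s: "s =o s" "abs_ordinal s = y"
        using Quotient3_ordinal by (auto simp: s_def Quotient3_def)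
      have "s <o r"
        using y s(1) 1(2) unfolding s(2)[symmetric] by (simp add: less_ordinal.abs_eq)
      with 1 s show "P y" by blast
    qed
  qed
  have "rep_ordinal a =o rep_ordinal a" "abs_ordinal (rep_ordinal a) = a"
    using Quotient3_ordinal by (auto simp: Quotient3_def)
  with * show "P a" by metis
qed

end

text \<open>The cardinal of a set, as an initial ordinal: the least order type of a well-order of the set.\<close>

lift_definition cardinal_of :: "'a set \<Rightarrow> 'a ordinal" is "\<lambda>X. |X|"
  by (rule card_of_refl)

definition weak_Freese_Nation_Pow_omega :: bool where
  "weak_Freese_Nation_Pow_omega \<longleftrightarrow>
    (\<exists>f :: nat set \<Rightarrow> nat set set.
      (\<forall>A. countable (f A)) \<and>
      (\<forall>A B. A \<subseteq> B \<longrightarrow> (\<exists>C \<in> f A \<inter> f B. A \<subseteq> C \<and> C \<subseteq> B)))"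

text \<open>Only the values of \<open>c\<close> on \<open>\<A>\<close> matter. The colours range over the ordinals below
  \<open>(2\<^sup>\<omega>)\<^sup>+\<close>, which loses nothing: the cardinal of \<open>Pow B \<inter> \<A>\<close> is at most \<open>2\<^sup>\<omega>\<close>,
  so colours from \<open>2\<^sup>\<omega>\<close> on can be replaced by \<open>0\<close>. The set \<open>{..< cardinal_of _}\<close> is
  this cardinal viewed as the set of smaller ordinals, and \<open>cardSuc natLeq\<close> is \<open>\<omega>\<^sub>1\<close>.\<close>

definition good_coloring ::
    "nat set set \<Rightarrow> nat set set \<Rightarrow> (nat set \<Rightarrow> nat set ordinal) \<Rightarrow> bool" where
  "good_coloring \<B> \<A> c \<longleftrightarrow>
    (\<forall>B \<in> \<B>. cardSuc natLeq \<le>o |Pow B \<inter> \<A>| \<longrightarrow>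
      {..< cardinal_of (Pow B \<inter> \<A>)} \<subseteq> c ` (Pow B \<inter> \<A>))"

end

theory Submission
  imports Defs "HOL-Library.Countable_Set_Type"
begin

text \<open>
  Fix a well-order of \<open>\<P>(\<omega>)\<close> in the order type of its cardinality and let the points of
  \<open>\<P>(\<omega>)\<close> themselves serve as colours, \<open>\<xi>\<close> standing for the order type of its set of
  predecessors. A submodel is a set \<open>N\<close> closed under the Freese--Nation function \<open>f\<close> that contains
  every \<open>\<xi>\<close> with fewer than \<open>|N|\<close> predecessors. Below any \<open>B\<close>, the countable set
  \<open>f B \<inter> N\<close> is cofinal in \<open>N\<close>.

  By induction on \<open>|M|\<close>, a colouring of a finite union of submodels extends over a further
  submodel \<open>M\<close> so that every \<open>B \<in> M\<close> sees every colour in \<open>M\<close> that it has to see. An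
  uncountable \<open>M\<close> is the union of a continuous chain of smaller submodels, and passing
  from one member of the chain to the next adds just one set to the finite list, as with Davies trees.
  For countable \<open>M\<close> the requests \<open>(B, \<xi>)\<close> are countable in number. If infinitely many
  elements of \<open>\<A>\<close> below \<open>B\<close> are uncoloured, a fresh one receives the colour \<open>\<xi>\<close>. Otherwise almost
  all of them lie in the old submodels; by cofinality, countably many sets \<open>\<P>(C) \<inter> \<A> \<inter> N\<close> with
  \<open>C \<in> f B \<inter> N\<close> cover these, so one of them is large enough that \<open>\<xi> \<in> N\<close> and that \<open>\<xi>\<close>
  already appears below \<open>C \<subseteq> B\<close>.
\<close>

section \<open>Initial segments of a well-order of least possible length\<close>

definition preds :: "'a \<Rightarrow> 'a set" where
  "preds \<xi> = underS |UNIV :: 'a set| \<xi>"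

definition downclosed :: "'a set \<Rightarrow> bool" where
  "downclosed V \<longleftrightarrow> (\<forall>\<xi>\<in>V. preds \<xi> \<subseteq> V)"

text \<open>The finite ordinals. Over an infinite type they pad an initial segment to an infinite
  one that is still smaller than any uncountable set exceeding the segment.\<close>

definition fin_preds :: "'a set" where
  "fin_preds = {\<xi>. finite (preds \<xi>)}"

lemma well_order_card_of_UNIV: "well_order_on UNIV |UNIV :: 'a set|"
  by (rule card_of_well_order_on)

lemma wf_preds: "wf {(\<beta>, \<alpha> :: 'a). \<beta> \<in> preds \<alpha>}"
proof -
  have "{(\<beta>, \<alpha> :: 'a). \<beta> \<in> preds \<alpha>} = |UNIV :: 'a set| - Id"
    by (auto simp: preds_def underS_def)
  then show ?thesis
    using well_order_card_of_UNIV[where 'a = 'a] by (simp add: well_order_on_def)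
qed

lemma preds_total:
  fixes \<alpha> \<beta> :: 'a
  shows "\<beta> = \<alpha> \<or> \<beta> \<in> preds \<alpha> \<or> \<alpha> \<in> preds \<beta>"
proof -
  have "total_on UNIV |UNIV :: 'a set|"
    using well_order_card_of_UNIV[where 'a = 'a]
    by (simp add: well_order_on_def linear_order_on_def)
  then show ?thesis
    unfolding preds_def underS_def total_on_def by blast
qed

lemma preds_trans:
  fixes \<alpha> \<beta> :: 'a
  assumes "\<beta> \<in> preds \<alpha>"
  shows "preds \<beta> \<subseteq> preds \<alpha>"
proof -
  have "trans |UNIV :: 'a set|" "antisym |UNIV :: 'a set|"
    using well_order_card_of_UNIV[where 'a = 'a]
    by (simp_all add: well_order_on_def linear_order_on_def partial_order_on_def preorder_on_def)
  then show ?thesis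
    using assms unfolding preds_def underS_def by (blast dest: transD antisymD)
qed

lemma downclosed_preds: "downclosed (preds \<xi>)"
  by (simp add: downclosed_def preds_trans)

lemma downclosed_Un: "downclosed V \<Longrightarrow> downclosed V' \<Longrightarrow> downclosed (V \<union> V')"
  unfolding downclosed_def by blast

lemma downclosed_subset_preds:
  assumes "downclosed V" "\<xi> \<notin> V"
  shows "V \<subseteq> preds \<xi>"
proof
  fix x assume "x \<in> V"
  then show "x \<in> preds \<xi>"
    using assms preds_total[of x \<xi>] by (auto simp: downclosed_def)
qed

lemma downclosed_mem:
  assumes "downclosed V" "|preds \<xi>| <o |V|"
  shows "\<xi> \<in> V"
proof (rule ccontr)
  assume "\<xi> \<notin> V"
  then have "|V| \<le>o |preds \<xi>|"
    by (intro card_of_mono1 downclosed_subset_preds assms(1))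
  with assms(2) show False
    using not_ordLess_ordLeq by blast
qed

lemma downclosed_UNIV_or:
  fixes V :: "'a set"
  assumes "downclosed V"
  obtains "V = UNIV" | \<xi> where "\<xi> \<notin> V" "V = preds \<xi>"
proof (cases "V = UNIV")
  case False
  then obtain x where x: "x \<in> - V" by auto
  obtain \<xi> where \<xi>: "\<xi> \<in> - V" "\<And>y. y \<in> preds \<xi> \<Longrightarrow> y \<notin> - V"
    by (rule wfE_min[OF wf_preds x]) auto
  then have "V = preds \<xi>"
    by (intro equalityI downclosed_subset_preds assms) auto
  with \<xi>(1) that(2) show ?thesis by simp
qed

lemma downclosed_fin_preds: "downclosed fin_preds"
proof -
  have "finite (preds \<beta>)" if "finite (preds \<alpha>)" "\<beta> \<in> preds \<alpha>" for \<alpha> \<beta> :: 'a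
    using that preds_trans[of \<beta> \<alpha>] finite_subset by simp
  then show ?thesis by (auto simp: downclosed_def fin_preds_def)
qed

lemma infinite_fin_preds:
  assumes "infinite (UNIV :: 'a set)"
  shows "infinite (fin_preds :: 'a set)"
  using downclosed_fin_preds[where 'a = 'a]
proof (cases rule: downclosed_UNIV_or)
  case 1
  then show ?thesis using assms by simp
next
  case (2 \<xi>)
  then show ?thesis by (simp add: fin_preds_def)
qed

text \<open>The number of predecessors increases strictly along the order.\<close>

lemma countable_fin_preds: "countable (fin_preds :: 'a set)"
proof (rule countableI)
  have mono: "card (preds \<beta>) < card (preds \<alpha>)" if "\<beta> \<in> preds \<alpha>" "\<alpha> \<in> fin_preds" for \<alpha> \<beta> :: 'a
  proof (rule psubset_card_mono)
    have "\<beta> \<notin> preds \<beta>" by (simp add: preds_def underS_def)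
    with that(1) preds_trans[OF that(1)] show "preds \<beta> \<subset> preds \<alpha>" by blast
  qed (use that(2) in \<open>simp add: fin_preds_def\<close>)
  show "inj_on (\<lambda>\<alpha>. card (preds \<alpha>)) (fin_preds :: 'a set)"
  proof (rule inj_onI)
    fix \<alpha> \<beta> :: 'a
    assume "\<alpha> \<in> fin_preds" "\<beta> \<in> fin_preds" "card (preds \<alpha>) = card (preds \<beta>)"
    then show "\<alpha> = \<beta>"
      using mono[of \<alpha> \<beta>] mono[of \<beta> \<alpha>] preds_total[of \<alpha> \<beta>] by auto
  qed
qed

lemma downclosed_small: "downclosed {\<xi> :: 'a. |preds \<xi>| <o |M| }"
proof -
  have "|preds \<beta>| <o |M|" if "|preds \<alpha>| <o |M|" "\<beta> \<in> preds \<alpha>" for \<alpha> \<beta> :: 'a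
    using ordLeq_ordLess_trans[OF card_of_mono1[OF preds_trans[OF that(2)]] that(1)] .
  then show ?thesis by (auto simp: downclosed_def)
qed

text \<open>A proper segment is cut off by a point outside it, which has at least \<open>|M|\<close>
  predecessors. The bound lets \<open>M\<close> be enumerated along the ordinals below
  \<open>|M|\<close>.\<close>

lemma card_le_small:
  fixes M :: "'a set"
  shows "|M| \<le>o |{\<xi> :: 'a. |preds \<xi>| <o |M| }|"
  using downclosed_small[where 'a = 'a, of M]
proof (cases rule: downclosed_UNIV_or)
  case 1
  show ?thesis unfolding 1 by (rule card_of_mono1) simp
next
  case (2 \<xi>)
  have "\<not> |preds \<xi>| <o |M|" using 2(1) by simp
  then show ?thesis unfolding 2(2)
    using ordLess_or_ordLeq[OF card_of_Well_order card_of_Well_order, of "preds \<xi>" M] by blast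
qed

section \<open>Cardinal arithmetic, closure and injective choice\<close>

lemma countable_ordLeq_infinite: "infinite V \<Longrightarrow> countable X \<Longrightarrow> |X| \<le>o |V|"
  by (metis countable_card_le_natLeq infinite_iff_natLeq_ordLeq ordLeq_transitive)

lemma countable_ordLess_uncountable: "countable X \<Longrightarrow> uncountable Y \<Longrightarrow> |X| <o |Y|"
  by (metis card_of_Well_order countable_card_le_natLeq ordLeq_transitive ordLess_or_ordLeq)

lemma Un_ordLeq_infinite:
  assumes "infinite V" "|X| \<le>o |V|" "|Y| \<le>o |V|"
  shows "|X \<union> Y| \<le>o |V|"
  by (rule card_of_Un_ordLeq_infinite_Field)
    (use assms card_of_Card_order in \<open>simp_all only: Field_card_of not_False_eq_True\<close>)

lemma ordLeq_Diff_infinite: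
  assumes "infinite M" "|L| <o |M|" "|M| \<le>o |X|"
  shows "|M| \<le>o |X - L|"
proof (rule ccontr)
  assume "\<not> |M| \<le>o |X - L|"
  then have "|X - L| <o |M|"
    using ordLess_or_ordLeq[OF card_of_Well_order card_of_Well_order, of "X - L" M] by blast
  then have "|(X - L) \<union> L| <o |M|"
    using assms by (intro card_of_Un_ordLess_infinite)
  then have "|X| <o |M|"
    by (rule ordLeq_ordLess_trans[OF card_of_mono1, rotated]) blast
  with assms(3) show False using not_ordLess_ordLeq by blast
qed

text \<open>The downward Loewenheim-Skolem argument: closing off in \<omega> stages costs only a
  countable union of sets of size at most \<open>|V|\<close>.\<close>

lemma closure_under:
  fixes S M V :: "'a set"
  assumes V: "infinite V" and S: "S \<subseteq> M" "|S| \<le>o |V|"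
    and k: "\<And>x. x \<in> M \<Longrightarrow> k x \<subseteq> M" "\<And>x. x \<in> M \<Longrightarrow> |k x| \<le>o |V|"
  shows "\<exists>G. S \<subseteq> G \<and> G \<subseteq> M \<and> |G| \<le>o |V| \<and> (\<forall>x\<in>G. k x \<subseteq> G)"
proof -
  define E where "E n = ((\<lambda>X. X \<union> (\<Union>x\<in>X. k x)) ^^ n) S" for n
  have E_Suc: "E (Suc n) = E n \<union> (\<Union>x\<in>E n. k x)" for n by (simp add: E_def)
  have E: "E n \<subseteq> M \<and> |E n| \<le>o |V|" for n
  proof (induction n)
    case 0
    then show ?case using S by (simp add: E_def)
  next
    case (Suc n)
    then have "|\<Union>x\<in>E n. k x| \<le>o |V|"
      by (intro card_of_UNION_ordLeq_infinite[OF V]) (use k in auto)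
    moreover have "(\<Union>x\<in>E n. k x) \<subseteq> M" using Suc k(1) by blast
    ultimately show ?case
      unfolding E_Suc using Suc Un_ordLeq_infinite[OF V, of "E n" "\<Union>x\<in>E n. k x"] by simp
  qed
  have "|\<Union>n. E n| \<le>o |V|"
    by (intro card_of_UNION_ordLeq_infinite[OF V]) (use E V in \<open>simp_all add: infinite_iff_card_of_nat\<close>)
  moreover have "S \<subseteq> (\<Union>n. E n)"
    by (rule order_trans[OF _ UN_upper[of 0]]) (auto simp: E_def)
  moreover have "\<forall>x\<in>\<Union>n. E n. k x \<subseteq> (\<Union>n. E n)"
    using E_Suc by blast
  moreover have "(\<Union>n. E n) \<subseteq> M"
    using E by blast
  ultimately show ?thesis by blast
qed

text \<open>Choices follow an enumeration of \<open>T\<close>, so each has only finitely many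
  earlier ones to avoid.\<close>

lemma countable_inj_choice:
  assumes "countable T" "\<And>t. t \<in> T \<Longrightarrow> infinite (X t)"
  shows "\<exists>g. inj_on g T \<and> (\<forall>t\<in>T. g t \<in> X t)"
proof -
  let ?P = "\<lambda>g t x. t \<in> T \<longrightarrow> x \<in> X t \<and> (\<forall>s\<in>T. to_nat_on T s < to_nat_on T t \<longrightarrow> x \<noteq> g s)"
  have "\<exists>g. \<forall>t. ?P g t (g t)"
  proof (rule dependent_wf_choice[OF wf_measure[of "to_nat_on T"]])
    fix g g' :: "'a \<Rightarrow> 'b" and t x
    assume "\<And>s. (s, t) \<in> measure (to_nat_on T) \<Longrightarrow> g s = g' s"
    then show "?P g t x = ?P g' t x" by auto
  next
    fix g :: "'a \<Rightarrow> 'b" and t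
    let ?S = "{s \<in> T. to_nat_on T s < to_nat_on T t}"
    have "finite ?S"
      by (rule inj_on_finite[of "to_nat_on T" _ "{..<to_nat_on T t}"])
        (use inj_on_to_nat_on[OF assms(1)] in \<open>auto simp: inj_on_def\<close>)
    then have "t \<in> T \<Longrightarrow> infinite (X t - g ` ?S)" using assms(2) by simp
    then show "\<exists>x. ?P g t x" using infinite_imp_nonempty by blast
  qed
  then obtain g where g: "\<And>t. ?P g t (g t)" by blast
  have "inj_on g T"
  proof (rule inj_onI)
    fix s t assume "s \<in> T" "t \<in> T" "g s = g t"
    then have "to_nat_on T s = to_nat_on T t" using g by (metis linorder_neqE_nat)
    then show "s = t" using \<open>s \<in> T\<close> \<open>t \<in> T\<close> assms(1) by simp
  qed
  then show ?thesis using g by blast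
qed

section \<open>Colourings and submodels\<close>

locale weak_Freese_Nation =
  fixes f :: "'a :: order \<Rightarrow> 'a set" and A :: "'a set"
  assumes countable_f: "countable (f x)"
    and interpolate: "x \<le> y \<Longrightarrow> \<exists>z\<in>f x \<inter> f y. x \<le> z \<and> z \<le> y"
begin

definition below :: "'a \<Rightarrow> 'a set" where
  "below B = {..B} \<inter> A"

text \<open>The points \<open>B\<close> and the colours \<open>\<xi>\<close> come from \<open>M\<close>, but the witness coloured
  \<open>\<xi>\<close> may be any element of \<open>Z\<close>: for a submodel \<open>M\<close> it may lie in an older one.\<close>

definition good :: "('a \<Rightarrow> 'a) \<Rightarrow> 'a set \<Rightarrow> 'a set \<Rightarrow> bool" where
  "good c M Z \<longleftrightarrow> (\<forall>B\<in>M. \<forall>\<xi>\<in>M. uncountable (below B) \<longrightarrow> |preds \<xi>| <o |below B| \<longrightarrow>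
    \<xi> \<in> c ` (below B \<inter> Z))"

definition submodel :: "'a set \<Rightarrow> bool" where
  "submodel N \<longleftrightarrow> (\<forall>x\<in>N. f x \<subseteq> N) \<and> (\<forall>\<xi>. |preds \<xi>| <o |N| \<longrightarrow> \<xi> \<in> N)"

text \<open>The disjunction, unlike elementarity over \<open>Y\<close>, passes from \<open>M\<close> to suitable
  smaller sets \<open>G \<subseteq> M\<close>, even if \<open>Y\<close> is then enlarged by a set of size at most \<open>|G|\<close>.\<close>

definition rich_over :: "'a set \<Rightarrow> 'a set \<Rightarrow> bool" where
  "rich_over Y M \<longleftrightarrow> (\<forall>B\<in>M. below B - Y \<subseteq> M \<or> |M| \<le>o |(below B - Y) \<inter> M| )"

lemma goodD:
  assumes "good c M Z" "B \<in> M" "\<xi> \<in> M" "uncountable (below B)" "|preds \<xi>| <o |below B|"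
  shows "\<exists>a. a \<in> below B \<and> a \<in> Z \<and> \<xi> = c a"
proof -
  have "\<xi> \<in> c ` (below B \<inter> Z)"
    using assms unfolding good_def by simp
  then show ?thesis by blast
qed

lemma good_mono_cong:
  assumes "good c M Z" "Z \<subseteq> Z'" "\<And>x. x \<in> Z \<Longrightarrow> c' x = c x"
  shows "good c' M Z'"
  unfolding good_def
proof (intro ballI impI)
  fix B \<xi>
  assume "B \<in> M" "\<xi> \<in> M" "uncountable (below B)" "|preds \<xi>| <o |below B|"
  from goodD[OF assms(1) this] obtain a where "a \<in> below B" "a \<in> Z" "\<xi> = c a"
    by blast
  then show "\<xi> \<in> c' ` (below B \<inter> Z')" using assms(2,3) by (intro image_eqI[of _ _ a]) auto
qed

text \<open>Since the \<open>G \<beta>\<close> form a chain, \<open>B\<close> and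
  \<open>\<xi>\<close> from the union already occur together in one \<open>G \<beta>\<close>, whose
  colouring provides the witness.\<close>

lemma good_glue:
  assumes "\<And>\<beta> \<beta>' x. \<beta> \<in> J \<Longrightarrow> \<beta>' \<in> J \<Longrightarrow> x \<in> G \<beta> \<Longrightarrow> x \<in> G \<beta>' \<Longrightarrow> C \<beta> x = C \<beta>' x"
    and "\<And>\<beta> x. \<beta> \<in> J \<Longrightarrow> x \<in> U \<Longrightarrow> C \<beta> x = c x"
    and "\<And>\<beta> \<beta>'. \<beta> \<in> J \<Longrightarrow> \<beta>' \<in> J \<Longrightarrow> G \<beta> \<subseteq> G \<beta>' \<or> G \<beta>' \<subseteq> G \<beta>"
    and "\<And>\<beta>. \<beta> \<in> J \<Longrightarrow> good (C \<beta>) (G \<beta>) (U \<union> G \<beta>)"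
  shows "\<exists>c'. (\<forall>x\<in>U. c' x = c x) \<and> (\<forall>\<beta>\<in>J. \<forall>x\<in>G \<beta>. c' x = C \<beta> x) \<and>
    good c' (\<Union>\<beta>\<in>J. G \<beta>) (U \<union> (\<Union>\<beta>\<in>J. G \<beta>))"
proof -
  define c' where "c' x = (if x \<in> U then c x else C (SOME \<beta>. \<beta> \<in> J \<and> x \<in> G \<beta>) x)" for x
  have c'_U: "c' x = c x" if "x \<in> U" for x using that by (simp add: c'_def)
  have c'_G: "c' x = C \<beta> x" if "\<beta> \<in> J" "x \<in> G \<beta>" for \<beta> x
  proof (cases "x \<in> U")
    case True
    then show ?thesis using assms(2) that c'_U by simp
  next
    case False
    define \<gamma> where "\<gamma> = (SOME \<beta>. \<beta> \<in> J \<and> x \<in> G \<beta>)"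
    have "\<gamma> \<in> J \<and> x \<in> G \<gamma>"
      unfolding \<gamma>_def by (rule someI[of "\<lambda>\<beta>. \<beta> \<in> J \<and> x \<in> G \<beta>" \<beta>]) (use that in simp)
    then have "C \<gamma> x = C \<beta> x" using assms(1)[of \<gamma> \<beta> x] that by blast
    then show ?thesis using False by (simp add: c'_def \<gamma>_def)
  qed
  have "good c' (\<Union>\<beta>\<in>J. G \<beta>) (U \<union> (\<Union>\<beta>\<in>J. G \<beta>))"
    unfolding good_def
  proof (intro ballI impI)
    fix B \<xi>
    assume "B \<in> (\<Union>\<beta>\<in>J. G \<beta>)" "\<xi> \<in> (\<Union>\<beta>\<in>J. G \<beta>)"
    then obtain \<beta> where \<beta>: "\<beta> \<in> J" "B \<in> G \<beta>" "\<xi> \<in> G \<beta>" using assms(3) by blast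
    assume big: "uncountable (below B)" "|preds \<xi>| <o |below B|"
    have "good c' (G \<beta>) (U \<union> (\<Union>\<beta>\<in>J. G \<beta>))"
      by (rule good_mono_cong[OF assms(4)[OF \<beta>(1)]]) (use \<beta>(1) assms(2) c'_U c'_G in auto)
    from goodD[OF this \<beta>(2,3) big] show "\<xi> \<in> c' ` (below B \<inter> (U \<union> (\<Union>\<beta>\<in>J. G \<beta>)))"
      by blast
  qed
  then show ?thesis using c'_U c'_G by blast
qed

section \<open>Extension over a countable set\<close>

lemma colour_from_submodels:
  assumes \<N>: "finite \<N>" "\<And>N. N \<in> \<N> \<Longrightarrow> submodel N" "\<And>N. N \<in> \<N> \<Longrightarrow> good c N (\<Union>\<N>)"
    and inf: "infinite (UNIV :: 'a set)"
    and big: "uncountable (below B)" "|preds \<xi>| <o |below B|"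
    and fin: "finite (below B - \<Union>\<N>)"
  shows "\<xi> \<in> c ` (below B \<inter> \<Union>\<N>)"
proof -
  \<comment> \<open>One bound for two needs: a set larger than \<open>V\<close> is larger than
    \<open>preds \<xi>\<close> and, \<open>V\<close> being infinite, uncountable.\<close>
  define V where "V = preds \<xi> \<union> fin_preds"
  have inf_V: "infinite V" using infinite_fin_preds[OF inf] by (simp add: V_def)
  have "|V| <o |below B|"
    unfolding V_def
    using big countable_ordLess_uncountable[OF countable_fin_preds big(1)] uncountable_infinite
    by (intro card_of_Un_ordLess_infinite)
  have "\<exists>N\<in>\<N>. \<exists>C\<in>f B \<inter> N \<inter> {..B}. |V| <o |below C \<inter> N|"
  proof (rule ccontr)
    assume "\<not> ?thesis"
    then have small: "|below C \<inter> N| \<le>o |V|" if "N \<in> \<N>" "C \<in> f B \<inter> N \<inter> {..B}" for N C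
      using that ordLess_or_ordLeq[OF card_of_Well_order card_of_Well_order, of V "below C \<inter> N"]
      by blast
    have "|\<Union>C\<in>f B \<inter> N \<inter> {..B}. below C \<inter> N| \<le>o |V|" if "N \<in> \<N>" for N
      using small[OF that] countable_f
      by (intro card_of_UNION_ordLeq_infinite[OF inf_V] countable_ordLeq_infinite[OF inf_V]) auto
    then have "|\<Union>N\<in>\<N>. \<Union>C\<in>f B \<inter> N \<inter> {..B}. below C \<inter> N| \<le>o |V|"
      using \<N>(1)
      by (intro card_of_UNION_ordLeq_infinite[OF inf_V] countable_ordLeq_infinite[OF inf_V])
        (auto intro: countable_finite)
    moreover have "|below B - \<Union>\<N>| \<le>o |V|"
      by (intro countable_ordLeq_infinite[OF inf_V] countable_finite fin)
    ultimately have "|(below B - \<Union>\<N>) \<union> (\<Union>N\<in>\<N>. \<Union>C\<in>f B \<inter> N \<inter> {..B}. below C \<inter> N)| \<le>o |V|"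
      by (intro Un_ordLeq_infinite[OF inf_V])
    moreover have "below B \<subseteq> (below B - \<Union>\<N>) \<union> (\<Union>N\<in>\<N>. \<Union>C\<in>f B \<inter> N \<inter> {..B}. below C \<inter> N)"
    proof
      fix x assume x: "x \<in> below B"
      show "x \<in> (below B - \<Union>\<N>) \<union> (\<Union>N\<in>\<N>. \<Union>C\<in>f B \<inter> N \<inter> {..B}. below C \<inter> N)"
      proof (cases "x \<in> \<Union>\<N>")
        case True
        then obtain N where N: "N \<in> \<N>" "x \<in> N" by blast
        \<comment> \<open>The interpolant between \<open>x\<close> and \<open>B\<close> lies in
          \<open>f x\<close>, hence in \<open>N\<close>; this is the cofinality of
          \<open>f B \<inter> N\<close>.\<close>
        from x obtain C where "C \<in> f x \<inter> f B" "x \<le> C" "C \<le> B"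
          using interpolate[of x B] by (auto simp: below_def)
        moreover have "f x \<subseteq> N" using \<N>(2) N by (auto simp: submodel_def)
        ultimately have "C \<in> f B \<inter> N \<inter> {..B}" "x \<in> below C \<inter> N"
          using x N by (auto simp: below_def)
        with N(1) show ?thesis by blast
      qed (use x in simp)
    qed
    ultimately have "|below B| \<le>o |V|"
      using ordLeq_transitive[OF card_of_mono1] by blast
    with not_ordLess_ordLeq[OF \<open>|V| <o |below B|\<close>] show False by simp
  qed
  then obtain N C where N: "N \<in> \<N>" and C: "C \<in> f B" "C \<in> N" "C \<le> B"
    and less: "|V| <o |below C \<inter> N|" by blast
  have preds_V: "|preds \<xi>| \<le>o |V|" by (rule card_of_mono1) (simp add: V_def)
  have "|preds \<xi>| <o |N|"
    by (rule ordLess_ordLeq_trans[OF ordLeq_ordLess_trans[OF preds_V less] card_of_mono1]) simp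
  then have \<xi>: "\<xi> \<in> N" using \<N>(2)[OF N] by (simp add: submodel_def)
  have V_C: "|V| <o |below C|"
    by (rule ordLess_ordLeq_trans[OF less card_of_mono1]) simp
  have unc: "uncountable (below C)"
    using not_ordLess_ordLeq[OF V_C] countable_ordLeq_infinite[OF inf_V] by metis
  from goodD[OF \<N>(3)[OF N] C(2) \<xi> unc ordLeq_ordLess_trans[OF preds_V V_C]]
  obtain a where "a \<in> below C" "a \<in> \<Union>\<N>" "\<xi> = c a"
    by blast
  moreover have "below C \<subseteq> below B" using C(3) by (auto simp: below_def)
  ultimately show ?thesis by blast
qed

lemma extend_countable:
  assumes \<N>: "finite \<N>" "\<And>N. N \<in> \<N> \<Longrightarrow> submodel N" "\<And>N. N \<in> \<N> \<Longrightarrow> good c N (\<Union>\<N>)"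
    and M: "infinite M" "countable M" "rich_over (\<Union>\<N>) M"
  shows "\<exists>c'. (\<forall>x\<in>\<Union>\<N>. c' x = c x) \<and> good c' M (\<Union>\<N> \<union> M)"
proof -
  \<comment> \<open>The requests that need a fresh point. Each gets its own, so no point has to
    carry two colours.\<close>
  define T where "T = {(B, \<xi>). B \<in> M \<and> \<xi> \<in> M \<and> infinite (below B - \<Union>\<N>)}"
  define X where "X t = (below (fst t) - \<Union>\<N>) \<inter> M" for t :: "'a \<times> 'a"
  have countable_T: "countable T"
    by (rule countable_subset[of _ "M \<times> M"]) (use M(2) in \<open>auto simp: T_def\<close>)
  have infinite_X: "infinite (X t)" if "t \<in> T" for t
  \<comment> \<open>Either alternative of richness suffices: \<open>X t\<close> is the whole fresh
    part, or at least as large as the infinite \<open>M\<close>.\<close>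
  proof (cases "below (fst t) - \<Union>\<N> \<subseteq> M")
    case True
    then have "X t = below (fst t) - \<Union>\<N>" unfolding X_def by blast
    then show ?thesis using that by (auto simp: T_def)
  next
    case False
    then have "|M| \<le>o |X t|"
      using M(3) that by (auto simp: rich_over_def T_def X_def)
    then show ?thesis using M(1) card_of_ordLeq_finite[of M "X t"] by blast
  qed
  from countable_inj_choice[of T X, OF countable_T infinite_X]
  obtain g where g: "inj_on g T" "\<And>t. t \<in> T \<Longrightarrow> g t \<in> X t"
    by blast
  \<comment> \<open>New points outside the range of \<open>g\<close> get an unspecified value; this
    is harmless, since goodness only demands that colours occur.\<close>
  define c' where "c' x = (if x \<in> \<Union>\<N> then c x else snd (the_inv_into T g x))" for x
  have "good c' M (\<Union>\<N> \<union> M)"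
    unfolding good_def
  proof (intro ballI impI)
    fix B \<xi>
    assume B: "B \<in> M" "\<xi> \<in> M" "uncountable (below B)" "|preds \<xi>| <o |below B|"
    show "\<xi> \<in> c' ` (below B \<inter> (\<Union>\<N> \<union> M))"
    proof (cases "finite (below B - \<Union>\<N>)")
      case True
      have "infinite (UNIV :: 'a set)" using M(1) finite_subset[OF subset_UNIV] by blast
      then have "\<xi> \<in> c ` (below B \<inter> \<Union>\<N>)"
        by (intro colour_from_submodels[OF \<N> _ B(3,4) True]) simp_all
      then obtain x where "x \<in> below B" "x \<in> \<Union>\<N>" "\<xi> = c x" by blast
      then show ?thesis by (intro image_eqI[of _ _ x]) (simp_all add: c'_def)
    next
      case False
      then have t: "(B, \<xi>) \<in> T" using B by (simp add: T_def)
      then have "g (B, \<xi>) \<in> below B" "g (B, \<xi>) \<in> M" "g (B, \<xi>) \<notin> \<Union>\<N>"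
        using g(2)[OF t] by (simp_all add: X_def)
      moreover from this(3) have "c' (g (B, \<xi>)) = \<xi>"
        using the_inv_into_f_f[OF g(1) t] by (simp add: c'_def)
      ultimately show ?thesis by (intro image_eqI[of _ _ "g (B, \<xi>)"]) simp_all
    qed
  qed
  then show ?thesis by (intro exI[of _ c']) (simp add: c'_def)
qed

section \<open>Filtration of an uncountable submodel\<close>

text \<open>One stage of the filtration: \<open>L\<close> is the union of the earlier stages,
  \<open>S\<close> holds the points to be captured, \<open>V\<close> fixes the size.
  \<open>G\<close> closes \<open>L \<union> S \<union> V\<close> under \<open>f\<close> and under a
  function \<open>K\<close> supplying the fresh points that richness demands.\<close>

lemma rich_submodel_subset:
  assumes M: "infinite M" "submodel M" "rich_over Y M"
    and V: "infinite V" "downclosed V" "|V| <o |M|"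
    and L: "L \<subseteq> M" "|L| \<le>o |V|" and S: "S \<subseteq> M" "|S| \<le>o |V|"
  shows "\<exists>G. L \<subseteq> G \<and> S \<subseteq> G \<and> V \<subseteq> G \<and> G \<subseteq> M \<and> |G| \<le>o |V| \<and> submodel G \<and> rich_over (Y \<union> L) G"
proof -
  define X where "X B = below B - (Y \<union> L)" for B
  \<comment> \<open>Take all fresh points of \<open>M\<close> below \<open>B\<close> if there are at
    most \<open>|V|\<close> of them, and otherwise exactly \<open>|V|\<close> many.\<close>
  have "\<exists>K. K \<subseteq> X B \<inter> M \<and> |K| \<le>o |V| \<and> (K = X B \<inter> M \<or> |V| \<le>o |K| )" for B
  proof (cases "|X B \<inter> M| \<le>o |V|")
    case False
    then have "|V| \<le>o |X B \<inter> M|"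
      using ordLeq_total[OF card_of_Well_order card_of_Well_order, of V "X B \<inter> M"] by blast
    then obtain K where "K \<subseteq> X B \<inter> M" "|V| =o |K|"
      unfolding internalize_card_of_ordLeq2[of V] by blast
    moreover from this(2) have "|V| \<le>o |K|" "|K| \<le>o |V|"
      by (simp_all add: ordIso_iff_ordLeq)
    ultimately show ?thesis by blast
  qed auto
  then obtain K where K: "\<And>B. K B \<subseteq> X B \<inter> M" "\<And>B. |K B| \<le>o |V|"
      "\<And>B. K B = X B \<inter> M \<or> |V| \<le>o |K B|"
    by metis
  have "V \<subseteq> M"
  proof
    fix \<xi> assume "\<xi> \<in> V"
    then have "|preds \<xi>| \<le>o |V|" using V(2) by (auto simp: downclosed_def intro: card_of_mono1)
    then have "|preds \<xi>| <o |M|" by (rule ordLeq_ordLess_trans[OF _ V(3)])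
    then show "\<xi> \<in> M" using M(2) by (simp add: submodel_def)
  qed
  have "\<exists>G. L \<union> S \<union> V \<subseteq> G \<and> G \<subseteq> M \<and> |G| \<le>o |V| \<and> (\<forall>B\<in>G. f B \<union> K B \<subseteq> G)"
  proof (rule closure_under[OF V(1)])
    show "L \<union> S \<union> V \<subseteq> M" using L(1) S(1) \<open>V \<subseteq> M\<close> by blast
    show "|L \<union> S \<union> V| \<le>o |V|"
      using L(2) S(2) by (intro Un_ordLeq_infinite[OF V(1)] card_of_mono1[OF subset_refl])
    show "f B \<union> K B \<subseteq> M" if "B \<in> M" for B
      using that M(2) K(1) by (auto simp: submodel_def)
    show "|f B \<union> K B| \<le>o |V|" for B
      using K(2) countable_f countable_ordLeq_infinite[OF V(1)]
      by (intro Un_ordLeq_infinite[OF V(1)]) auto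
  qed
  then obtain G where G: "L \<subseteq> G" "S \<subseteq> G" "V \<subseteq> G" "G \<subseteq> M" "|G| \<le>o |V|"
      "\<And>B. B \<in> G \<Longrightarrow> f B \<subseteq> G" "\<And>B. B \<in> G \<Longrightarrow> K B \<subseteq> G"
    by auto
  have "submodel G"
    unfolding submodel_def
  proof (intro conjI ballI allI impI)
    fix \<xi> :: 'a assume "|preds \<xi>| <o |G|"
    then have "|preds \<xi>| <o |V|" by (rule ordLess_ordLeq_trans[OF _ G(5)])
    then show "\<xi> \<in> G" using downclosed_mem[OF V(2), of \<xi>] G(3) by blast
  qed (use G(6) in blast)
  moreover have "rich_over (Y \<union> L) G"
    unfolding rich_over_def X_def[symmetric]
  proof
    fix B assume B: "B \<in> G"
    have KG: "K B \<subseteq> X B \<inter> G" using K(1)[of B] G(7)[OF B] by blast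
    show "X B \<subseteq> G \<or> |G| \<le>o |X B \<inter> G|"
    proof (cases "|V| \<le>o |K B|")
      case True
      have "|G| \<le>o |X B \<inter> G|"
        by (rule ordLeq_transitive[OF G(5) ordLeq_transitive[OF True card_of_mono1[OF KG]]])
      then show ?thesis by simp
    next
      case False
      then have eq: "K B = X B \<inter> M" using K(3) by blast
      \<comment> \<open>Removing the smaller set \<open>L\<close> from at least \<open>|M|\<close>
        points would leave \<open>K B\<close> too large. So the first alternative holds for
        \<open>M\<close>, and \<open>K B\<close> is all of \<open>X B\<close>.\<close>
      have "\<not> |M| \<le>o |(below B - Y) \<inter> M|"
      proof
        assume "|M| \<le>o |(below B - Y) \<inter> M|"
        then have "|M| \<le>o |(below B - Y) \<inter> M - L|"
          by (rule ordLeq_Diff_infinite[OF M(1) ordLeq_ordLess_trans[OF L(2) V(3)]])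
        also have "(below B - Y) \<inter> M - L = K B" unfolding eq X_def by blast
        finally have "|M| \<le>o |K B|" .
        then have "|V| \<le>o |K B|"
          by (rule ordLeq_transitive[OF ordLess_imp_ordLeq[OF V(3)]])
        with False show False by simp
      qed
      then have "below B - Y \<subseteq> M"
        using M(3) B G(4) unfolding rich_over_def by auto
      then have "X B \<subseteq> K B" unfolding eq X_def by blast
      then show ?thesis using KG by blast
    qed
  qed
  ultimately show ?thesis using G by blast
qed

text \<open>Stages are built by recursion along the ordinals below \<open>|M|\<close>. The union of
  the earlier stages has to be a submodel as well, because it will join the finite list.\<close>

lemma submodel_filtration:
  assumes M: "uncountable M" "submodel M" "rich_over Y M"
  shows "\<exists>(I :: 'a set) (G :: 'a \<Rightarrow> 'a set). (\<forall>\<alpha>\<in>I. preds \<alpha> \<subseteq> I) \<and> M = (\<Union>\<alpha>\<in>I. G \<alpha>) \<and>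
    (\<forall>\<alpha>\<in>I. submodel (\<Union>\<beta>\<in>preds \<alpha>. G \<beta>) \<and> (\<forall>\<beta>\<in>preds \<alpha>. G \<beta> \<subseteq> G \<alpha>) \<and>
      |G \<alpha>| <o |M| \<and> infinite (G \<alpha>) \<and> submodel (G \<alpha>) \<and> rich_over (Y \<union> (\<Union>\<beta>\<in>preds \<alpha>. G \<beta>)) (G \<alpha>))"
proof -
  define I where "I = {\<alpha> :: 'a. |preds \<alpha>| <o |M| }"
  define V where "V \<alpha> = preds \<alpha> \<union> fin_preds" for \<alpha> :: 'a
  define L where "L G \<alpha> = (\<Union>\<beta>\<in>preds \<alpha>. G \<beta>)" for G :: "'a \<Rightarrow> 'a set" and \<alpha>
  have inf_M: "infinite M" using M(1) uncountable_infinite by blast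
  have I_preds: "preds \<alpha> \<subseteq> I" if "\<alpha> \<in> I" for \<alpha>
    using that downclosed_small[where 'a = 'a, of M] by (simp add: downclosed_def I_def)
  have I_M: "\<alpha> \<in> M" if "\<alpha> \<in> I" for \<alpha>
    using that M(2) by (simp add: submodel_def I_def)
  have "M \<noteq> {}" using inf_M by auto
  \<comment> \<open>Putting \<open>e \<alpha>\<close> into \<open>G \<alpha>\<close> makes the
    stages exhaust \<open>M\<close>.\<close>
  then obtain e where e: "e ` I = M"
    using card_of_ordLeq2[of M I] card_le_small[of M] unfolding I_def by auto
  have inf_V: "infinite (V \<alpha>)" for \<alpha>
    unfolding V_def using infinite_fin_preds inf_M finite_subset[OF subset_UNIV] by blast
  have downclosed_V: "downclosed (V \<alpha>)" for \<alpha>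
    unfolding V_def by (intro downclosed_Un downclosed_preds downclosed_fin_preds)
  have V_less: "|V \<alpha>| <o |M|" if "\<alpha> \<in> I" for \<alpha>
    unfolding V_def
    using that countable_ordLess_uncountable[OF countable_fin_preds M(1)]
    by (intro card_of_Un_ordLess_infinite[OF inf_M]) (simp_all add: I_def)
  have preds_V: "|preds \<alpha>| \<le>o |V \<alpha>|" for \<alpha>
    by (rule card_of_mono1) (simp add: V_def)
  \<comment> \<open>\<open>\<alpha> \<in> X\<close> and \<open>V \<alpha> \<subseteq> X\<close>
    serve to make the later unions \<open>L G \<alpha>\<close> submodels.\<close>
  define P where "P G \<alpha> X \<longleftrightarrow> (\<alpha> \<in> I \<longrightarrow> L G \<alpha> \<subseteq> X \<and> \<alpha> \<in> X \<and> e \<alpha> \<in> X \<and> V \<alpha> \<subseteq> X \<and> X \<subseteq> M \<and>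
      |X| \<le>o |V \<alpha>| \<and> submodel (L G \<alpha>) \<and> submodel X \<and> rich_over (Y \<union> L G \<alpha>) X)" for G \<alpha> X
  have "\<exists>G. \<forall>\<alpha>. P G \<alpha> (G \<alpha>)"
  proof (rule dependent_wf_choice[OF wf_preds])
    fix G G' :: "'a \<Rightarrow> 'a set" and \<alpha> :: 'a and X :: "'a set"
    assume "\<And>\<beta>. (\<beta>, \<alpha>) \<in> {(\<beta>, \<alpha>). \<beta> \<in> preds \<alpha>} \<Longrightarrow> G \<beta> = G' \<beta>"
    then have "L G \<alpha> = L G' \<alpha>" by (simp add: L_def)
    then show "P G \<alpha> X = P G' \<alpha> X" by (simp add: P_def)
  next
    fix \<alpha> :: 'a and G :: "'a \<Rightarrow> 'a set"
    assume IH: "\<And>\<beta>. (\<beta>, \<alpha>) \<in> {(\<beta>, \<alpha>). \<beta> \<in> preds \<alpha>} \<Longrightarrow> P G \<beta> (G \<beta>)"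
    show "\<exists>X. P G \<alpha> X"
    proof (cases "\<alpha> \<in> I")
      case True
      have G: "\<beta> \<in> G \<beta>" "V \<beta> \<subseteq> G \<beta>" "G \<beta> \<subseteq> M" "|G \<beta>| \<le>o |V \<beta>|" "submodel (G \<beta>)" if "\<beta> \<in> preds \<alpha>" for \<beta>
        using IH[of \<beta>] that I_preds[OF True] by (auto simp: P_def)
      have "L G \<alpha> \<subseteq> M" using G(3) by (auto simp: L_def)
      have L_V: "|L G \<alpha>| \<le>o |V \<alpha>|"
        unfolding L_def
      proof (rule card_of_UNION_ordLeq_infinite[OF inf_V preds_V], rule ballI)
        fix \<beta> assume \<beta>: "\<beta> \<in> preds \<alpha>"
        have "|V \<beta>| \<le>o |V \<alpha>|"
          by (rule card_of_mono1) (use preds_trans[OF \<beta>] in \<open>auto simp: V_def\<close>)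
        with G(4)[OF \<beta>] show "|G \<beta>| \<le>o |V \<alpha>|" by (rule ordLeq_transitive)
      qed
      have "submodel (L G \<alpha>)"
        unfolding submodel_def
      proof (intro conjI ballI allI impI)
        fix x assume "x \<in> L G \<alpha>"
        then obtain \<beta> where "\<beta> \<in> preds \<alpha>" "x \<in> G \<beta>" by (auto simp: L_def)
        moreover from this have "f x \<subseteq> G \<beta>" using G(5)[of \<beta>] by (simp add: submodel_def)
        ultimately show "f x \<subseteq> L G \<alpha>" by (auto simp: L_def)
      next
        fix \<xi> :: 'a assume less: "|preds \<xi>| <o |L G \<alpha>|"
        then have "|preds \<xi>| <o |V \<alpha>|" by (rule ordLess_ordLeq_trans[OF _ L_V])
        then have \<xi>: "\<xi> \<in> V \<alpha>" by (rule downclosed_mem[OF downclosed_V])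
        \<comment> \<open>Some earlier stage exists and contains \<open>fin_preds\<close>; every
          other point of \<open>V \<alpha>\<close> enters at its own stage.\<close>
        have "preds \<alpha> \<noteq> {}"
        proof
          assume "preds \<alpha> = {}"
          with less have "|preds \<xi>| <o |{} :: 'a set|" by (simp add: L_def)
          from not_ordLess_ordLeq[OF this] card_of_empty show False by (rule notE)
        qed
        then obtain \<beta> where \<beta>: "\<beta> \<in> preds \<alpha>" by blast
        show "\<xi> \<in> L G \<alpha>"
        proof (cases "\<xi> \<in> fin_preds")
          case True
          then have "\<xi> \<in> G \<beta>" using G(2)[OF \<beta>] by (auto simp: V_def)
          then show ?thesis using \<beta> by (auto simp: L_def)
        next
          case False
          then have "\<xi> \<in> preds \<alpha>" using \<xi> by (simp add: V_def)
          then show ?thesis using G(1) by (auto simp: L_def)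
        qed
      qed
      moreover have "\<exists>X. L G \<alpha> \<subseteq> X \<and> {\<alpha>, e \<alpha>} \<subseteq> X \<and> V \<alpha> \<subseteq> X \<and> X \<subseteq> M \<and> |X| \<le>o |V \<alpha>| \<and>
          submodel X \<and> rich_over (Y \<union> L G \<alpha>) X"
      proof (rule rich_submodel_subset[OF inf_M M(2,3) inf_V downclosed_V V_less[OF True] \<open>L G \<alpha> \<subseteq> M\<close> L_V])
        show "{\<alpha>, e \<alpha>} \<subseteq> M" using True e I_M by blast
        show "|{\<alpha>, e \<alpha>}| \<le>o |V \<alpha>|" by (intro countable_ordLeq_infinite[OF inf_V]) simp
      qed
      ultimately show ?thesis by (auto simp: P_def)
    qed (simp add: P_def)
  qed
  then obtain G where "\<And>\<alpha>. P G \<alpha> (G \<alpha>)" by blast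
  then have G: "L G \<alpha> \<subseteq> G \<alpha>" "\<alpha> \<in> G \<alpha>" "e \<alpha> \<in> G \<alpha>" "V \<alpha> \<subseteq> G \<alpha>" "G \<alpha> \<subseteq> M" "|G \<alpha>| \<le>o |V \<alpha>|"
      "submodel (L G \<alpha>)" "submodel (G \<alpha>)" "rich_over (Y \<union> L G \<alpha>) (G \<alpha>)" if "\<alpha> \<in> I" for \<alpha>
    using that unfolding P_def by simp_all
  have "M = (\<Union>\<alpha>\<in>I. G \<alpha>)" using G(3,5) e by blast
  moreover have "submodel (L G \<alpha>) \<and> (\<forall>\<beta>\<in>preds \<alpha>. G \<beta> \<subseteq> G \<alpha>) \<and>
      |G \<alpha>| <o |M| \<and> infinite (G \<alpha>) \<and> submodel (G \<alpha>) \<and> rich_over (Y \<union> L G \<alpha>) (G \<alpha>)" if "\<alpha> \<in> I" for \<alpha>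
  proof (intro conjI ballI)
    show "G \<beta> \<subseteq> G \<alpha>" if "\<beta> \<in> preds \<alpha>" for \<beta>
      using G(1)[OF \<open>\<alpha> \<in> I\<close>] that by (auto simp: L_def)
    show "|G \<alpha>| <o |M|" by (rule ordLeq_ordLess_trans[OF G(6) V_less]) (rule that)+
    show "infinite (G \<alpha>)" using G(4)[OF that] inf_V[of \<alpha>] finite_subset by metis
  qed (use G[OF that] in simp_all)
  ultimately show ?thesis
    using I_preds unfolding L_def by (intro exI[of _ I] exI[of _ G]) simp
qed

section \<open>Transfinite extension of colourings\<close>

text \<open>Induction on \<open>|M|\<close> for all \<open>\<N>\<close> and \<open>c\<close> at
  once. Each stage \<open>G \<alpha>\<close> is smaller than \<open>M\<close> and is coloured over
  \<open>\<N>\<close> enlarged by the single set \<open>L\<close>, the union of the earlier stages,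
  so the list stays finite however long the chain.\<close>

lemma extend_good:
  assumes "finite \<N>" "\<And>N. N \<in> \<N> \<Longrightarrow> submodel N" "\<And>N. N \<in> \<N> \<Longrightarrow> good c N (\<Union>\<N>)"
    and "infinite M" "submodel M" "rich_over (\<Union>\<N>) M"
  shows "\<exists>c'. (\<forall>x\<in>\<Union>\<N>. c' x = c x) \<and> good c' M (\<Union>\<N> \<union> M)"
  using assms
proof (induction M arbitrary: \<N> c rule: wf_induct_rule[OF wf_inv_image[OF wf_ordLess, of card_of]])
  case (1 M)
  show ?case
  proof (cases "countable M")
    case True
    then show ?thesis using extend_countable[OF 1(2-4,5) _ 1(7)] by simp
  next
    case False
    obtain I :: "'a set" and G :: "'a \<Rightarrow> 'a set" where I: "\<forall>\<alpha>\<in>I. preds \<alpha> \<subseteq> I" and M: "M = (\<Union>\<alpha>\<in>I. G \<alpha>)"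
      and filtration: "\<forall>\<alpha>\<in>I. submodel (\<Union>\<beta>\<in>preds \<alpha>. G \<beta>) \<and> (\<forall>\<beta>\<in>preds \<alpha>. G \<beta> \<subseteq> G \<alpha>) \<and>
        |G \<alpha>| <o |M| \<and> infinite (G \<alpha>) \<and> submodel (G \<alpha>) \<and>
        rich_over (\<Union>\<N> \<union> (\<Union>\<beta>\<in>preds \<alpha>. G \<beta>)) (G \<alpha>)"
      using submodel_filtration[OF False 1(6,7)] by (elim exE conjE) (rule that)
    have G: "submodel (\<Union>\<beta>\<in>preds \<alpha>. G \<beta>)" "\<And>\<beta>. \<beta> \<in> preds \<alpha> \<Longrightarrow> G \<beta> \<subseteq> G \<alpha>"
        "|G \<alpha>| <o |M|" "infinite (G \<alpha>)" "submodel (G \<alpha>)"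
        "rich_over (\<Union>\<N> \<union> (\<Union>\<beta>\<in>preds \<alpha>. G \<beta>)) (G \<alpha>)" if "\<alpha> \<in> I" for \<alpha>
      using bspec[OF filtration that] by blast+
    have G_chain: "G \<beta> \<subseteq> G \<beta>' \<or> G \<beta>' \<subseteq> G \<beta>" if "\<beta> \<in> I" "\<beta>' \<in> I" for \<beta> \<beta>'
      using preds_total[of \<beta> \<beta>'] G(2)[of \<beta> \<beta>'] G(2)[of \<beta>' \<beta>] that by auto
    define P where "P C \<alpha> c' \<longleftrightarrow> (\<alpha> \<in> I \<longrightarrow> (\<forall>x\<in>\<Union>\<N>. c' x = c x) \<and>
        (\<forall>\<beta>\<in>preds \<alpha>. \<forall>x\<in>G \<beta>. c' x = C \<beta> x) \<and> good c' (G \<alpha>) (\<Union>\<N> \<union> G \<alpha>))"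
      for C :: "'a \<Rightarrow> 'a \<Rightarrow> 'a" and \<alpha> c'
    have glue: "\<exists>c'. (\<forall>x\<in>\<Union>\<N>. c' x = c x) \<and> (\<forall>\<beta>\<in>J. \<forall>x\<in>G \<beta>. c' x = C \<beta> x) \<and>
        good c' (\<Union>\<beta>\<in>J. G \<beta>) (\<Union>\<N> \<union> (\<Union>\<beta>\<in>J. G \<beta>))"
      if J: "J \<subseteq> I" and P: "\<And>\<beta>. \<beta> \<in> J \<Longrightarrow> P C \<beta> (C \<beta>)" for J C
    proof (rule good_glue)
      have *: "C \<beta> x = C \<beta>' x" if "\<beta> \<in> J" "\<beta>' \<in> preds \<beta>" "x \<in> G \<beta>'" for \<beta> \<beta>' x
        using P[OF that(1)] that J unfolding P_def by auto
      show "C \<beta> x = C \<beta>' x" if "\<beta> \<in> J" "\<beta>' \<in> J" "x \<in> G \<beta>" "x \<in> G \<beta>'" for \<beta> \<beta>' x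
        using preds_total[of \<beta> \<beta>'] *[of \<beta> \<beta>' x] *[of \<beta>' \<beta> x] that by auto
      show "C \<beta> x = c x" if "\<beta> \<in> J" "x \<in> \<Union>\<N>" for \<beta> x
        using P[OF that(1)] that J unfolding P_def by blast
      show "G \<beta> \<subseteq> G \<beta>' \<or> G \<beta>' \<subseteq> G \<beta>" if "\<beta> \<in> J" "\<beta>' \<in> J" for \<beta> \<beta>'
        using G_chain that J by blast
      show "good (C \<beta>) (G \<beta>) (\<Union>\<N> \<union> G \<beta>)" if "\<beta> \<in> J" for \<beta>
        using P[OF that] that J unfolding P_def by blast
    qed
    have "\<exists>C. \<forall>\<alpha>. P C \<alpha> (C \<alpha>)"
    proof (rule dependent_wf_choice[OF wf_preds])
      fix C C' :: "'a \<Rightarrow> 'a \<Rightarrow> 'a" and \<alpha> :: 'a and c'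
      assume "\<And>\<beta>. (\<beta>, \<alpha>) \<in> {(\<beta>, \<alpha>). \<beta> \<in> preds \<alpha>} \<Longrightarrow> C \<beta> = C' \<beta>"
      then show "P C \<alpha> c' = P C' \<alpha> c'" by (simp add: P_def)
    next
      fix \<alpha> :: 'a and C :: "'a \<Rightarrow> 'a \<Rightarrow> 'a"
      assume P: "\<And>\<beta>. (\<beta>, \<alpha>) \<in> {(\<beta>, \<alpha>). \<beta> \<in> preds \<alpha>} \<Longrightarrow> P C \<beta> (C \<beta>)"
      show "\<exists>c'. P C \<alpha> c'"
      proof (cases "\<alpha> \<in> I")
        case True
        define L where "L = (\<Union>\<beta>\<in>preds \<alpha>. G \<beta>)"
        have P': "P C \<beta> (C \<beta>)" if "\<beta> \<in> preds \<alpha>" for \<beta>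
          using P that by simp
        \<comment> \<open>Gluing over \<open>preds \<alpha>\<close> colours \<open>L\<close> itself
          and so admits it to the list; successor and limit stages are treated alike.\<close>
        from glue[OF bspec[OF I True] P']
        obtain c1 where c1: "\<And>x. x \<in> \<Union>\<N> \<Longrightarrow> c1 x = c x"
            "\<And>\<beta> x. \<beta> \<in> preds \<alpha> \<Longrightarrow> x \<in> G \<beta> \<Longrightarrow> c1 x = C \<beta> x" "good c1 L (\<Union>\<N> \<union> L)"
          unfolding L_def by blast
        have L_G: "L \<subseteq> G \<alpha>" using G(2)[OF True] by (auto simp: L_def)
        have Un: "\<Union>(insert L \<N>) = \<Union>\<N> \<union> L" by auto
        have "\<exists>c'. (\<forall>x\<in>\<Union>(insert L \<N>). c' x = c1 x) \<and> good c' (G \<alpha>) (\<Union>(insert L \<N>) \<union> G \<alpha>)"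
        proof (rule 1(1))
          show "(G \<alpha>, M) \<in> inv_image ordLess card_of" using G(3)[OF True] by simp
          show "finite (insert L \<N>)" using 1(2) by simp
          show "submodel N" if "N \<in> insert L \<N>" for N
            using that 1(3) G(1)[OF True] by (auto simp: L_def)
          show "good c1 N (\<Union>(insert L \<N>))" if "N \<in> insert L \<N>" for N
          proof (cases "N = L")
            case False
            \<comment> \<open>Old members stay good: \<open>c1\<close> extends \<open>c\<close>, and
              a larger union only offers more witnesses.\<close>
            then have "good c N (\<Union>\<N>)" using that 1(4) by blast
            then show ?thesis by (rule good_mono_cong) (use c1(1) in auto)
          qed (use c1(3) in \<open>simp only: Un\<close>)
          show "infinite (G \<alpha>)" "submodel (G \<alpha>)" using G(4,5)[OF True] by auto
          show "rich_over (\<Union>(insert L \<N>)) (G \<alpha>)"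
            unfolding Un using G(6)[OF True] by (simp only: L_def)
        qed
        then obtain c' where c': "\<And>x. x \<in> \<Union>\<N> \<union> L \<Longrightarrow> c' x = c1 x"
            "good c' (G \<alpha>) (\<Union>\<N> \<union> L \<union> G \<alpha>)"
          unfolding Un by blast
        have "\<Union>\<N> \<union> L \<union> G \<alpha> = \<Union>\<N> \<union> G \<alpha>" using L_G by blast
        with c'(2) have "good c' (G \<alpha>) (\<Union>\<N> \<union> G \<alpha>)" by (simp only:)
        moreover have "c' x = c x" if "x \<in> \<Union>\<N>" for x
          using c'(1)[of x] c1(1)[OF that] that by simp
        moreover have "c' x = C \<beta> x" if "\<beta> \<in> preds \<alpha>" "x \<in> G \<beta>" for \<beta> x
        proof -
          have "x \<in> L" unfolding L_def using that by (rule UN_I)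
          then show ?thesis using c'(1)[of x] c1(2)[OF that] by simp
        qed
        ultimately have "P C \<alpha> c'" by (simp add: P_def)
        then show ?thesis by (rule exI[where x = c'])
      qed (simp add: P_def)
    qed
    then obtain C where "\<And>\<alpha>. P C \<alpha> (C \<alpha>)" by blast
    from glue[OF subset_refl this] show ?thesis unfolding M by blast
  qed
qed

lemma good_UNIV:
  assumes "infinite (UNIV :: 'a set)"
  shows "\<exists>c. good c UNIV UNIV"
proof -
  have "submodel UNIV" "rich_over (\<Union>{}) UNIV" by (simp_all add: submodel_def rich_over_def)
  then show ?thesis using extend_good[of "{}" _ UNIV] assms by auto
qed

end

section \<open>Transfer to ordinal colours\<close>

definition ordinal_of :: "'a \<Rightarrow> 'a ordinal" where
  "ordinal_of \<xi> = abs_ordinal (Restr |UNIV| (preds \<xi>))"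

text \<open>An ordinal below \<open>|X|\<close> is below \<open>|UNIV|\<close>, hence the order type
  of a proper initial segment \<open>preds \<xi>\<close>. Cardinals being least among the
  well-orders of a set, \<open>|preds \<xi>|\<close> is at most this ordinal.\<close>

lemma less_cardinal_of_imp_ordinal_of:
  fixes x :: "'a ordinal" and X :: "'a set"
  assumes "x < cardinal_of X"
  shows "\<exists>\<xi>. |preds \<xi>| <o |X| \<and> x = ordinal_of \<xi>"
proof -
  define s where "s = rep_ordinal x"
  have s: "s =o s" "abs_ordinal s = x"
    using Quotient3_ordinal by (auto simp: s_def Quotient3_def)
  have less: "s <o |X|"
    using assms s(1) card_of_refl[of X]
    unfolding s(2)[symmetric] cardinal_of.abs_eq by (simp add: less_ordinal.abs_eq)
  have "|X| \<le>o |UNIV :: 'a set|" by (rule card_of_mono1) simp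
  then have "s <o |UNIV :: 'a set|" by (rule ordLess_ordLeq_trans[OF less])
  then obtain \<xi> :: 'a where \<xi>: "s =o Restr |UNIV| (underS |UNIV| \<xi>)"
    using ordLess_iff_ordIso_Restr[OF card_of_Well_order, of s UNIV] s(1)
    by (auto simp: ordIso_self_iff)
  then have \<xi>': "s =o Restr |UNIV| (preds \<xi>)" by (simp add: preds_def)
  have W: "Well_order (Restr |UNIV| (preds \<xi>))"
    using \<xi>' by (simp add: ordIso_def)
  have "x = ordinal_of \<xi>"
    unfolding s(2)[symmetric] ordinal_of_def
    by (rule Quotient3_rel_abs[OF Quotient3_ordinal \<xi>'])
  moreover have "Field (Restr |UNIV| (preds \<xi>)) = preds \<xi>"
    using well_order_card_of_UNIV[where 'a = 'a]
    by (intro Refl_Field_Restr2)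
      (simp_all add: well_order_on_def linear_order_on_def partial_order_on_def preorder_on_def
        Field_card_of)
  then have "|preds \<xi>| \<le>o Restr |UNIV| (preds \<xi>)"
    using W card_of_least by metis
  then have "|preds \<xi>| <o |X|"
    using ordLeq_ordLess_trans ordIso_ordLess_trans ordIso_symmetric \<xi>' less by metis
  ultimately show ?thesis by blast
qed

theorem theorem6p8:
  fixes \<A> \<B> :: "nat set set"
  assumes "weak_Freese_Nation_Pow_omega"
  shows "\<exists>c. good_coloring \<B> \<A> c"
proof -
  obtain f :: "nat set \<Rightarrow> nat set set" where f: "\<And>A. countable (f A)"
      "\<And>A B. A \<subseteq> B \<Longrightarrow> \<exists>C \<in> f A \<inter> f B. A \<subseteq> C \<and> C \<subseteq> B"
    using assms unfolding weak_Freese_Nation_Pow_omega_def by blast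
  interpret weak_Freese_Nation f \<A>
    by standard (use f in auto)
  have "infinite (UNIV :: nat set set)" by (simp add: Finite_Set.finite_set)
  then obtain c where c: "good c UNIV UNIV" using good_UNIV by blast
  \<comment> \<open>Each ordinal to be seen below \<open>B\<close> is
    \<open>ordinal_of \<xi>\<close> for a colour \<open>\<xi>\<close> that \<open>c\<close> realizes
    below \<open>B\<close>.\<close>
  have "good_coloring \<B> \<A> (ordinal_of \<circ> c)"
    unfolding good_coloring_def
  proof (intro ballI impI subsetI)
    fix B x
    assume "cardSuc natLeq \<le>o |Pow B \<inter> \<A>|" and "x \<in> {..< cardinal_of (Pow B \<inter> \<A>)}"
    have B: "below B = Pow B \<inter> \<A>" by (auto simp: below_def)
    have "natLeq <o |Pow B \<inter> \<A>|"
      by (rule ordLess_ordLeq_trans[OF cardSuc_greater[OF natLeq_Card_order]]) fact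
    then have unc: "uncountable (below B)"
      unfolding B countable_card_le_natLeq using not_ordLess_ordLeq by blast
    obtain \<xi> where \<xi>: "|preds \<xi>| <o |below B|" "x = ordinal_of \<xi>"
      using less_cardinal_of_imp_ordinal_of \<open>x \<in> _\<close> unfolding B by blast
    from goodD[OF c UNIV_I UNIV_I unc \<xi>(1)]
    show "x \<in> (ordinal_of \<circ> c) ` (Pow B \<inter> \<A>)"
      using \<xi>(2) unfolding B by auto
  qed
  then show ?thesis by blast
qed

end
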